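(* Let $t\in\mathbb{N}$ and let $\Omega=\{1,\dots,n\}$. Any set function $f:2^{\Omega}\to\mathbb{R}$ that is $t$-sos-submodular is submodular.
   Context: $\mathbb{N}$ includes $0$. A set function $f:2^\Omega\to\mathbb{R}$ is submodular if $f(S)+f(T)\ge f(S\cup T)+f(S\cap T)$ for all $S,T\subseteq\Omega$. The multilinear extension (MLE) of $f$ is the unique multilinear polynomial $F\in\mathbb{R}[x_1,\dots,x_n]$ (every variable appears with power at most $1$ in every monomial) with $F(1_S)=f(S)$ for all $S\subseteq\Omega$, where $1_S\in\{0,1\}^n$ is the indicator vector of $S$. For an ideal $I$ of a real polynomial ring, a polynomial $p$ is $t$-sos modulo $I$ if there are finitely many polynomials $q_1,\dots,q_m$ in that ring, each of degree at most $t$, with $p-\sum_{r=1}^m q_r^2\in I$. For $i\ne j$, $x_{-i,j}$ denotes the variables $x_1,\dots,x_n$ with $x_i,x_j$ removed, and $I_2[x_{-i,j}]=\langle x_k^2-x_k : k\neq i,j\rangle\subseteq\mathbb{R}[x_{-i,j}]$. The set function $f$ with MLE $F$ is $t$-sos-submodular if for all $i\neq j$ in $\{1,\dots,n\}$ the polynomial $-\frac{\partial^2F(x)}{\partial x_i\partial x_j}$ (which does not involve $x_i,x_j$) is $t$-sos modulo $I_2[x_{-i,j}]$. *)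

theory Defs
  imports
    Complex_Main
    "HOL-Library.Poly_Mapping"
    "HOL-Library.Indicator_Function"
    "HOL-Algebra.Ideal"
begin

text \<open>
  A monomial is its finitely supported exponent vector, a polynomial maps monomials to
  coefficients; the ring operations are those of the type class instances of \<open>\<Rightarrow>\<^sub>0\<close>.
  The variables are indexed by all natural numbers, so the ring of real polynomials in the
  variables with index in \<open>V\<close> appears as the subset \<open>polys_in V\<close>.
\<close>

type_synonym monomial = "nat \<Rightarrow>\<^sub>0 nat"
type_synonym mpoly = "monomial \<Rightarrow>\<^sub>0 real"

definition Var :: "nat \<Rightarrow> mpoly" where
  "Var k = Poly_Mapping.single (Poly_Mapping.single k 1) 1"

definition polys_in :: "nat set \<Rightarrow> mpoly set" where
  "polys_in V = {p. \<forall>m\<in>Poly_Mapping.keys p. Poly_Mapping.keys m \<subseteq> V}"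

definition poly_ring :: "nat set \<Rightarrow> mpoly ring" where
  "poly_ring V = \<lparr>carrier = polys_in V, mult = (*), one = 1, zero = 0, add = (+)\<rparr>"

definition monomial_degree :: "monomial \<Rightarrow> nat" where
  "monomial_degree m = (\<Sum>k\<in>Poly_Mapping.keys m. Poly_Mapping.lookup m k)"

text \<open>The zero polynomial gets degree \<open>0\<close>.\<close>

definition total_degree :: "mpoly \<Rightarrow> nat" where
  "total_degree p = Max (insert 0 (monomial_degree ` Poly_Mapping.keys p))"

definition eval_monomial :: "(nat \<Rightarrow> real) \<Rightarrow> monomial \<Rightarrow> real" where
  "eval_monomial x m = (\<Prod>k\<in>Poly_Mapping.keys m. x k ^ Poly_Mapping.lookup m k)"

definition eval_poly :: "(nat \<Rightarrow> real) \<Rightarrow> mpoly \<Rightarrow> real" where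
  "eval_poly x p = (\<Sum>m\<in>Poly_Mapping.keys p. Poly_Mapping.lookup p m * eval_monomial x m)"

text \<open>
  Formal partial derivative. The exponent subtraction is truncated, which is harmless because
  the coefficient vanishes for monomials without \<open>Var i\<close>.
\<close>

definition partial_deriv :: "nat \<Rightarrow> mpoly \<Rightarrow> mpoly" where
  "partial_deriv i p = (\<Sum>m\<in>Poly_Mapping.keys p.
     Poly_Mapping.single (m - Poly_Mapping.single i 1)
       (real (Poly_Mapping.lookup m i) * Poly_Mapping.lookup p m))"

definition multilinear :: "mpoly \<Rightarrow> bool" where
  "multilinear p \<longleftrightarrow> (\<forall>m\<in>Poly_Mapping.keys p. \<forall>k. Poly_Mapping.lookup m k \<le> 1)"

text \<open>
  A set function on \<open>{1..n}\<close> is a total function on sets of which only the values on subsets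
  of \<open>{1..n}\<close> are used.
\<close>

definition is_MLE :: "nat \<Rightarrow> (nat set \<Rightarrow> real) \<Rightarrow> mpoly \<Rightarrow> bool" where
  "is_MLE n f F \<longleftrightarrow> F \<in> polys_in {1..n} \<and> multilinear F \<and>
     (\<forall>S\<subseteq>{1..n}. eval_poly (indicator S) F = f S)"

text \<open>Existence and uniqueness are established in \<open>MLE_ex1\<close> below.\<close>

definition MLE :: "nat \<Rightarrow> (nat set \<Rightarrow> real) \<Rightarrow> mpoly" where
  "MLE n f = (THE F. is_MLE n f F)"

definition submodular_on :: "nat set \<Rightarrow> (nat set \<Rightarrow> real) \<Rightarrow> bool" where
  "submodular_on \<Omega> f \<longleftrightarrow> (\<forall>S T. S \<subseteq> \<Omega> \<longrightarrow> T \<subseteq> \<Omega> \<longrightarrow> f S + f T \<ge> f (S \<union> T) + f (S \<inter> T))"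

text \<open>Here \<open>I\<close> is meant to be an ideal of \<open>poly_ring V\<close>.\<close>

definition sos_mod :: "nat set \<Rightarrow> mpoly set \<Rightarrow> nat \<Rightarrow> mpoly \<Rightarrow> bool" where
  "sos_mod V I t p \<longleftrightarrow> (\<exists>qs :: mpoly list.
     (\<forall>q\<in>set qs. q \<in> polys_in V \<and> total_degree q \<le> t) \<and> p - (\<Sum>q\<leftarrow>qs. q\<^sup>2) \<in> I)"

definition boolean_ideal :: "nat set \<Rightarrow> mpoly set" where
  "boolean_ideal V = genideal (poly_ring V) {(Var k)\<^sup>2 - Var k | k. k \<in> V}"

definition sos_submodular :: "nat \<Rightarrow> nat \<Rightarrow> (nat set \<Rightarrow> real) \<Rightarrow> bool" where
  "sos_submodular t n f \<longleftrightarrow> (\<forall>i\<in>{1..n}. \<forall>j\<in>{1..n}. i \<noteq> j \<longrightarrow>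
     sos_mod ({1..n} - {i, j}) (boolean_ideal ({1..n} - {i, j})) t
       (- partial_deriv i (partial_deriv j (MLE n f))))"


lemma keys_plus_nat:
  fixes m m' :: monomial
  shows "Poly_Mapping.keys (m + m') = Poly_Mapping.keys m \<union> Poly_Mapping.keys m'"
  by (auto simp: in_keys_iff lookup_add)

lemma polys_in_add: "p \<in> polys_in V \<Longrightarrow> q \<in> polys_in V \<Longrightarrow> p + q \<in> polys_in V"
  unfolding polys_in_def using Poly_Mapping.keys_add[of p q] by blast

lemma polys_in_uminus: "p \<in> polys_in V \<Longrightarrow> - p \<in> polys_in V"
  unfolding polys_in_def by simp

lemma polys_in_mult:
  assumes "p \<in> polys_in V" "q \<in> polys_in V"
  shows "p * q \<in> polys_in V"
proof -
  have "Poly_Mapping.keys m \<subseteq> V" if "m \<in> Poly_Mapping.keys (p * q)" for m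
  proof -
    obtain a b where "m = a + b" "a \<in> Poly_Mapping.keys p" "b \<in> Poly_Mapping.keys q"
      using keys_mult[of p q] \<open>m \<in> Poly_Mapping.keys (p * q)\<close> by blast
    then show ?thesis
      using assms by (auto simp: polys_in_def keys_plus_nat)
  qed
  then show ?thesis
    by (simp add: polys_in_def)
qed

lemma polys_in_0: "0 \<in> polys_in V" and polys_in_1: "1 \<in> polys_in V"
  by (auto simp: polys_in_def)

lemma cring_poly_ring: "cring (poly_ring V)"
proof (rule cringI)
  show "abelian_group (poly_ring V)"
  proof (rule abelian_groupI)
    fix x assume "x \<in> carrier (poly_ring V)"
    then show "\<exists>y\<in>carrier (poly_ring V). y \<oplus>\<^bsub>poly_ring V\<^esub> x = \<zero>\<^bsub>poly_ring V\<^esub>"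
      by (intro bexI[of _ "- x"]) (auto simp: poly_ring_def polys_in_uminus)
  qed (auto simp: poly_ring_def polys_in_0 polys_in_add ac_simps)
  show "comm_monoid (poly_ring V)"
    by (rule comm_monoidI) (auto simp: poly_ring_def polys_in_1 polys_in_mult ac_simps)
qed (auto simp: poly_ring_def distrib_right)

lemma eval_poly_superset:
  assumes "finite A" "Poly_Mapping.keys p \<subseteq> A"
  shows "eval_poly x p = (\<Sum>m\<in>A. Poly_Mapping.lookup p m * eval_monomial x m)"
  unfolding eval_poly_def
  by (rule sum.mono_neutral_left) (use assms in \<open>auto simp: in_keys_iff\<close>)

lemma eval_poly_add: "eval_poly x (p + q) = eval_poly x p + eval_poly x q"
proof -
  let ?A = "Poly_Mapping.keys p \<union> Poly_Mapping.keys q"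
  have "eval_poly x r = (\<Sum>m\<in>?A. Poly_Mapping.lookup r m * eval_monomial x m)"
    if "r \<in> {p, q, p + q}" for r
    using that Poly_Mapping.keys_add[of p q] by (intro eval_poly_superset) auto
  then show ?thesis
    by (simp add: lookup_add sum.distrib distrib_right)
qed

lemma eval_poly_single:
  "eval_poly x (Poly_Mapping.single m c) = c * eval_monomial x m"
  by (auto simp: eval_poly_def)

lemma eval_poly_uminus: "eval_poly x (- p) = - eval_poly x p"
  by (simp add: eval_poly_def sum_negf)

lemma eval_monomial_indicator:
  "eval_monomial (indicator S) m = (if Poly_Mapping.keys m \<subseteq> S then 1 else 0)"
proof (cases "Poly_Mapping.keys m \<subseteq> S")
  case True
  then show ?thesis
    by (auto simp: eval_monomial_def indicator_def intro!: prod.neutral)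
next
  case False
  then obtain k where "k \<in> Poly_Mapping.keys m" "k \<notin> S" by blast
  then show ?thesis
    using False by (auto simp: eval_monomial_def indicator_def in_keys_iff intro!: prod_zero)
qed

lemma multilinear_zero_unique:
  assumes ml: "multilinear p" and V: "p \<in> polys_in V"
    and z: "\<And>S. finite S \<Longrightarrow> S \<subseteq> V \<Longrightarrow> eval_poly (indicator S) p = 0"
  shows "p = 0"
proof (rule ccontr)
  assume "p \<noteq> 0"
  define m where "m = arg_min_on (\<lambda>m. card (Poly_Mapping.keys m)) (Poly_Mapping.keys p)"
  have m: "m \<in> Poly_Mapping.keys p"
    unfolding m_def using \<open>p \<noteq> 0\<close> by (intro arg_min_if_finite(1)) auto
  have min: "card (Poly_Mapping.keys m) \<le> card (Poly_Mapping.keys m')"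
    if "m' \<in> Poly_Mapping.keys p" for m'
    unfolding m_def using \<open>p \<noteq> 0\<close> that by (intro arg_min_least) auto
  have only: "m' = m"
    if "m' \<in> Poly_Mapping.keys p" "Poly_Mapping.keys m' \<subseteq> Poly_Mapping.keys m" for m'
  proof -
    have eq: "Poly_Mapping.keys m' = Poly_Mapping.keys m"
      using that min by (intro card_seteq) auto
    show ?thesis
    proof (rule poly_mapping_eqI)
      fix k
      have "Poly_Mapping.lookup m' k \<le> 1" "Poly_Mapping.lookup m k \<le> 1"
        using ml m that by (auto simp: multilinear_def)
      moreover have "Poly_Mapping.lookup m' k = 0 \<longleftrightarrow> Poly_Mapping.lookup m k = 0"
        using eq by (metis in_keys_iff)
      ultimately show "Poly_Mapping.lookup m' k = Poly_Mapping.lookup m k"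
        by linarith
    qed
  qed
  have "eval_poly (indicator (Poly_Mapping.keys m)) p =
      (\<Sum>m'\<in>Poly_Mapping.keys p. if m' = m then Poly_Mapping.lookup p m' else 0)"
    unfolding eval_poly_def eval_monomial_indicator
    using only by (intro sum.cong) auto
  also have "\<dots> = Poly_Mapping.lookup p m"
    using m by simp
  finally have "Poly_Mapping.lookup p m = 0"
    using z[of "Poly_Mapping.keys m"] m V by (auto simp: polys_in_def)
  then show False
    using m by (simp add: in_keys_iff)
qed

lemma multilinear_add: "multilinear p \<Longrightarrow> multilinear q \<Longrightarrow> multilinear (p + q)"
  unfolding multilinear_def using Poly_Mapping.keys_add[of p q] by blast

lemma multilinear_uminus: "multilinear p \<Longrightarrow> multilinear (- p)"
  unfolding multilinear_def by simp

text \<open>Interpolation on a finite down-closed family of sets, adding one maximal set at a time.\<close>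

lemma multilinear_interpolation:
  assumes "finite V" "finite A" "A \<subseteq> Pow V" "\<And>S T. S \<in> A \<Longrightarrow> T \<subseteq> S \<Longrightarrow> T \<in> A"
  shows "\<exists>p. p \<in> polys_in V \<and> multilinear p \<and> (\<forall>S\<in>A. eval_poly (indicator S) p = f S)"
  using assms(2-4)
proof (induction "card A" arbitrary: A)
  case 0
  then show ?case
    by (intro exI[of _ 0]) (auto simp: polys_in_0 multilinear_def)
next
  case (Suc c)
  then have "A \<noteq> {}" by auto
  then obtain M where M: "M \<in> A" "\<And>S. S \<in> A \<Longrightarrow> M \<subseteq> S \<Longrightarrow> M = S"
    using finite_has_maximal[OF \<open>finite A\<close>] by metis
  have "\<exists>p. p \<in> polys_in V \<and> multilinear p \<and> (\<forall>S\<in>A - {M}. eval_poly (indicator S) p = f S)"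
  proof (rule Suc.hyps(1))
    show "c = card (A - {M})" using Suc.hyps(2) M(1) by simp
    show "finite (A - {M})" "A - {M} \<subseteq> Pow V" using Suc.prems by auto
    show "\<And>S T. S \<in> A - {M} \<Longrightarrow> T \<subseteq> S \<Longrightarrow> T \<in> A - {M}"
      using Suc.prems(3) M(2) by blast
  qed
  then obtain p where p: "p \<in> polys_in V" "multilinear p"
    "\<And>S. S \<in> A - {M} \<Longrightarrow> eval_poly (indicator S) p = f S" by blast
  have MV: "M \<subseteq> V" "finite M"
    using M(1) Suc.prems(2) \<open>finite V\<close> by (auto intro: finite_subset)
  define m :: monomial where "m = Abs_poly_mapping (\<lambda>k. if k \<in> M then 1 else 0)"
  have lm: "Poly_Mapping.lookup m = (\<lambda>k. if k \<in> M then 1 else 0)"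
    unfolding m_def using MV(2) by (intro lookup_Abs_poly_mapping) auto
  have km: "Poly_Mapping.keys m = M"
    by (auto simp: in_keys_iff lm split: if_splits)
  define q where "q = Poly_Mapping.single m (f M - eval_poly (indicator M) p)"
  have q: "q \<in> polys_in V" "multilinear q"
    using MV by (auto simp: q_def polys_in_def multilinear_def km lm)
  have "eval_poly (indicator S) (p + q) = f S" if "S \<in> A" for S
  proof (cases "S = M")
    case True
    then show ?thesis
      by (simp add: eval_poly_add q_def eval_poly_single eval_monomial_indicator km)
  next
    case False
    then have "\<not> M \<subseteq> S" using M(2) that by blast
    then show ?thesis
      using p(3) that False
      by (simp add: eval_poly_add q_def eval_poly_single eval_monomial_indicator km)
  qed
  then show ?case
    using polys_in_add[OF p(1) q(1)] multilinear_add[OF p(2) q(2)]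
    by (intro exI[of _ "p + q"]) simp
qed

lemma MLE_ex1: "\<exists>!F. is_MLE n f F"
proof (rule ex_ex1I)
  show "\<exists>F. is_MLE n f F"
    using multilinear_interpolation[of "{1..n}" "Pow {1..n}" f]
    by (auto simp: is_MLE_def)
next
  fix F G assume F: "is_MLE n f F" and G: "is_MLE n f G"
  have "F + - G = 0"
  proof (rule multilinear_zero_unique)
    show "multilinear (F + - G)" "F + - G \<in> polys_in {1..n}"
      using F G unfolding is_MLE_def
      by (blast intro: multilinear_add multilinear_uminus polys_in_add polys_in_uminus)+
    show "eval_poly (indicator S) (F + - G) = 0" if "S \<subseteq> {1..n}" for S
      using F G that unfolding is_MLE_def eval_poly_add eval_poly_uminus by simp
  qed
  then show "F = G" by simp
qed

lemma is_MLE_MLE: "is_MLE n f (MLE n f)"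
  unfolding MLE_def by (rule theI'[OF MLE_ex1])

end

theory Submission
  imports Defs
begin

text \<open>
  Write \<open>F\<close> for the multilinear extension of \<open>f\<close>. Since \<open>F\<close> has degree at most one in each
  variable, differentiating it amounts to taking differences between its values at the two
  endpoints of an edge of the cube \<open>{0, 1}\<^sup>n\<close>. Therefore the value of \<open>- \<partial>\<^sup>2F / \<partial>x\<^sub>i \<partial>x\<^sub>j\<close>
  at the vertex \<open>1\<^sub>A\<close>, with \<open>i\<close> and \<open>j\<close> outside \<open>A\<close>, is
  \<open>f (A \<union> {i}) + f (A \<union> {j}) - f (A \<union> {i, j}) - f A\<close>
  (\<open>eval_mixed_partial_deriv_MLE\<close>).

  Every polynomial in the ideal generated by the \<open>x\<^sub>k\<^sup>2 - x\<^sub>k\<close> vanishes at the vertices of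
  the cube, so a polynomial that is a sum of squares modulo this ideal is nonnegative there
  (\<open>sos_mod_boolean_ideal_nonneg\<close>). Hence \<open>f\<close> satisfies the submodular
  inequality on every two-dimensional face of the cube, and this local condition implies
  submodularity by adding up faces (\<open>submodular_on_if_local\<close>).
\<close>

lemma eval_poly_sum: "eval_poly x (sum g A) = (\<Sum>a\<in>A. eval_poly x (g a))"
  by (induction A rule: infinite_finite_induct) (auto simp: eval_poly_add eval_poly_def[of _ 0])

lemma eval_monomial_superset:
  assumes "finite A" "Poly_Mapping.keys m \<subseteq> A"
  shows "eval_monomial x m = (\<Prod>k\<in>A. x k ^ Poly_Mapping.lookup m k)"
  unfolding eval_monomial_def
  by (rule prod.mono_neutral_left) (use assms in \<open>auto simp: in_keys_iff\<close>)

lemma eval_monomial_add: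
  "eval_monomial x (m + m') = eval_monomial x m * eval_monomial x m'"
proof -
  let ?A = "Poly_Mapping.keys m \<union> Poly_Mapping.keys m'"
  have "eval_monomial x a = (\<Prod>k\<in>?A. x k ^ Poly_Mapping.lookup a k)" if "a \<in> {m, m', m + m'}" for a
    using that by (intro eval_monomial_superset) (auto simp: keys_plus_nat)
  then show ?thesis
    by (simp add: lookup_add power_add prod.distrib)
qed

lemma poly_eq_sum_monomials:
  fixes p :: mpoly
  shows "p = (\<Sum>m\<in>Poly_Mapping.keys p. Poly_Mapping.single m (Poly_Mapping.lookup p m))"
  by (rule poly_mapping_eqI)
    (simp add: lookup_sum lookup_single when_def in_keys_iff if_distrib[of "\<lambda>f. f _"] cong: if_cong)

lemma eval_poly_mult: "eval_poly x (p * q) = eval_poly x p * eval_poly x q"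
proof -
  have "p * q = (\<Sum>m\<in>Poly_Mapping.keys p. \<Sum>m'\<in>Poly_Mapping.keys q.
      Poly_Mapping.single (m + m') (Poly_Mapping.lookup p m * Poly_Mapping.lookup q m'))"
    by (subst (1) poly_eq_sum_monomials[of p], subst (1) poly_eq_sum_monomials[of q])
      (simp add: sum_product mult_single)
  then have "eval_poly x (p * q) = (\<Sum>m\<in>Poly_Mapping.keys p. \<Sum>m'\<in>Poly_Mapping.keys q.
      (Poly_Mapping.lookup p m * eval_monomial x m) *
      (Poly_Mapping.lookup q m' * eval_monomial x m'))"
    by (simp add: eval_poly_sum eval_poly_single eval_monomial_add ac_simps)
  then show ?thesis
    by (simp only: eval_poly_def sum_product)
qed

lemma ideal_vanishing_polys: "ideal {p \<in> polys_in V. eval_poly x p = 0} (poly_ring V)"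
proof (rule idealI)
  show "ring (poly_ring V)"
    using cring_poly_ring by (rule cring.axioms(1))
  have "inv\<^bsub>add_monoid (poly_ring V)\<^esub> p = - p" if "p \<in> polys_in V" for p
  proof -
    interpret cring "poly_ring V" by (rule cring_poly_ring)
    have "\<ominus>\<^bsub>poly_ring V\<^esub> p = - p"
      by (rule minus_equality) (use that in \<open>auto simp: poly_ring_def polys_in_uminus\<close>)
    then show ?thesis by (simp add: a_inv_def)
  qed
  then show "subgroup {p \<in> polys_in V. eval_poly x p = 0} (add_monoid (poly_ring V))"
    by (intro subgroup.intro)
      (auto simp: poly_ring_def polys_in_add polys_in_0 polys_in_uminus eval_poly_add
        eval_poly_uminus eval_poly_def[of _ 0])
qed (auto simp: poly_ring_def polys_in_mult eval_poly_mult)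

text \<open>
  The vanishing polynomials form an ideal, and it contains each generator \<open>x\<^sub>k\<^sup>2 - x\<^sub>k\<close>
  because indicators take only the values \<open>0\<close> and \<open>1\<close>.
\<close>

lemma eval_boolean_ideal:
  assumes "p \<in> boolean_ideal V"
  shows "eval_poly (indicator S) p = 0"
proof -
  interpret cring "poly_ring V" by (rule cring_poly_ring)
  have Var: "Var k \<in> polys_in V" if "k \<in> V" for k
    using that by (simp add: Var_def polys_in_def)
  have "(Var k)\<^sup>2 - Var k \<in> {p \<in> polys_in V. eval_poly (indicator S) p = 0}" if "k \<in> V" for k
  proof -
    have "Var k * Var k + - Var k \<in> polys_in V"
      using Var[OF that] by (intro polys_in_add polys_in_mult polys_in_uminus)
    moreover have "eval_poly (indicator S) (Var k * Var k + - Var k) = 0"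
      unfolding eval_poly_add eval_poly_mult eval_poly_uminus
      by (simp add: Var_def eval_poly_single eval_monomial_indicator)
    ultimately show ?thesis
      by (simp add: power2_eq_square)
  qed
  then have "boolean_ideal V \<subseteq> {p \<in> polys_in V. eval_poly (indicator S) p = 0}"
    unfolding boolean_ideal_def by (intro genideal_minimal ideal_vanishing_polys) blast
  then show ?thesis
    using assms by blast
qed

lemma sos_mod_boolean_ideal_nonneg:
  assumes "sos_mod V (boolean_ideal V) t p"
  shows "eval_poly (indicator S) p \<ge> 0"
proof -
  obtain qs where "p - (\<Sum>q\<leftarrow>qs. q\<^sup>2) \<in> boolean_ideal V"
    using assms unfolding sos_mod_def by blast
  then have "eval_poly (indicator S) (p - (\<Sum>q\<leftarrow>qs. q\<^sup>2)) = 0"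
    by (rule eval_boolean_ideal)
  then have "eval_poly (indicator S) p = eval_poly (indicator S) (\<Sum>q\<leftarrow>qs. q\<^sup>2)"
    using eval_poly_add[of _ "p - (\<Sum>q\<leftarrow>qs. q\<^sup>2)" "\<Sum>q\<leftarrow>qs. q\<^sup>2"] by simp
  also have "\<dots> = (\<Sum>q\<leftarrow>qs. (eval_poly (indicator S) q)\<^sup>2)"
    by (induction qs) (simp_all add: eval_poly_def[of _ 0] eval_poly_add eval_poly_mult power2_eq_square)
  also have "\<dots> \<ge> 0"
    by (induction qs) auto
  finally show ?thesis .
qed

lemma multilinear_sum:
  assumes "\<And>a. a \<in> A \<Longrightarrow> multilinear (g a)"
  shows "multilinear (sum g A)"
  using assms
  by (induction A rule: infinite_finite_induct) (simp_all add: multilinear_add multilinear_def[of 0])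

lemma multilinear_partial_deriv:
  assumes "multilinear p"
  shows "multilinear (partial_deriv i p)"
  unfolding partial_deriv_def
proof (rule multilinear_sum)
  fix m assume "m \<in> Poly_Mapping.keys p"
  then have "Poly_Mapping.lookup m k \<le> 1" for k
    using assms by (simp add: multilinear_def)
  then have "Poly_Mapping.lookup m k - d \<le> 1" for k d
    by (rule order_trans[OF diff_le_self])
  then show "multilinear (Poly_Mapping.single (m - Poly_Mapping.single i 1)
      (real (Poly_Mapping.lookup m i) * Poly_Mapping.lookup p m))"
    by (simp add: multilinear_def lookup_minus)
qed

text \<open>
  It suffices to look at one monomial: if \<open>x\<^sub>i\<close> is absent, both sides are zero; otherwise its
  exponent is one, the monomial vanishes at \<open>S - {i}\<close>, and at \<open>insert i S\<close> the factor
  \<open>x\<^sub>i\<close> is one, leaving the monomial without it.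
\<close>

lemma eval_partial_deriv_multilinear:
  assumes "multilinear p"
  shows "eval_poly (indicator S) (partial_deriv i p) =
    eval_poly (indicator (insert i S)) p - eval_poly (indicator (S - {i})) p"
proof -
  have "real (Poly_Mapping.lookup m i) * eval_monomial (indicator S) (m - Poly_Mapping.single i 1) =
      eval_monomial (indicator (insert i S)) m - eval_monomial (indicator (S - {i})) m"
    if "m \<in> Poly_Mapping.keys p" for m
  proof (cases "Poly_Mapping.lookup m i = 0")
    case True
    then have "Poly_Mapping.keys m \<subseteq> insert i S \<longleftrightarrow> Poly_Mapping.keys m \<subseteq> S - {i}"
      by (auto simp: in_keys_iff)
    then show ?thesis
      using True by (simp add: eval_monomial_indicator)
  next
    case False
    then have 1: "Poly_Mapping.lookup m i = 1"
      using assms that unfolding multilinear_def by (metis le_neq_implies_less less_one)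
    then have "Poly_Mapping.keys (m - Poly_Mapping.single i 1) = Poly_Mapping.keys m - {i}"
      by (auto simp: in_keys_iff lookup_minus lookup_single when_def split: if_splits)
    moreover have "i \<in> Poly_Mapping.keys m"
      using 1 by (simp add: in_keys_iff)
    ultimately show ?thesis
      using 1 by (auto simp: eval_monomial_indicator)
  qed
  then have "eval_poly (indicator S) (partial_deriv i p) = (\<Sum>m\<in>Poly_Mapping.keys p.
      Poly_Mapping.lookup p m *
        (eval_monomial (indicator (insert i S)) m - eval_monomial (indicator (S - {i})) m))"
    unfolding partial_deriv_def eval_poly_sum eval_poly_single
    by (intro sum.cong) (simp_all add: mult.assoc mult.left_commute)
  then show ?thesis
    by (simp only: right_diff_distrib sum_subtractf eval_poly_def)
qed

lemma eval_mixed_partial_deriv_MLE: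
  assumes "i \<in> {1..n}" "j \<in> {1..n}" "i \<noteq> j" "A \<subseteq> {1..n} - {i, j}"
  shows "eval_poly (indicator A) (partial_deriv i (partial_deriv j (MLE n f))) =
    f (insert i (insert j A)) - f (insert i A) - f (insert j A) + f A"
proof -
  let ?F = "MLE n f"
  have ml: "multilinear ?F" and F: "\<And>S. S \<subseteq> {1..n} \<Longrightarrow> eval_poly (indicator S) ?F = f S"
    using is_MLE_MLE[of n f] by (auto simp: is_MLE_def)
  have "A - {i} = A" "A - {j} = A" "insert i A - {j} = insert i A"
    using assms by auto
  then have "eval_poly (indicator A) (partial_deriv i (partial_deriv j ?F)) =
      eval_poly (indicator (insert j (insert i A))) ?F - eval_poly (indicator (insert i A)) ?F
      - (eval_poly (indicator (insert j A)) ?F - eval_poly (indicator A) ?F)"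
    by (simp only: eval_partial_deriv_multilinear ml multilinear_partial_deriv)
  moreover have "A \<subseteq> {1..n}"
    using assms by blast
  ultimately show ?thesis
    using assms by (simp add: F insert_commute)
qed

text \<open>
  The hypothesis says that adding one element to \<open>A\<close> does not increase the marginal gain
  \<open>f (insert i A) - f A\<close>. Iterating shows that marginal gains decrease along inclusions, and
  adding the elements of \<open>S - T\<close> one by one to \<open>S \<inter> T\<close> and to \<open>T\<close> compares the total gains.
\<close>

lemma submodular_on_if_local:
  assumes "finite \<Omega>"
    and local: "\<And>i j A. i \<in> \<Omega> \<Longrightarrow> j \<in> \<Omega> \<Longrightarrow> i \<noteq> j \<Longrightarrow> A \<subseteq> \<Omega> - {i, j} \<Longrightarrow>
      f (insert i (insert j A)) + f A \<le> f (insert i A) + f (insert j A)"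
  shows "submodular_on \<Omega> f"
proof -
  have gain: "f (insert i (A \<union> D)) - f (A \<union> D) \<le> f (insert i A) - f A"
    if "finite D" "A \<union> D \<subseteq> \<Omega>" "i \<in> \<Omega> - (A \<union> D)" for A D i
    using that
  proof (induction D)
    case (insert d D)
    have IH: "f (insert i (A \<union> D)) - f (A \<union> D) \<le> f (insert i A) - f A"
      using insert by auto
    show ?case
    proof (cases "d \<in> A")
      case True
      then have "A \<union> insert d D = A \<union> D" by blast
      then show ?thesis using IH by metis
    next
      case False
      then have "f (insert i (insert d (A \<union> D))) + f (A \<union> D)
          \<le> f (insert i (A \<union> D)) + f (insert d (A \<union> D))"
        using insert by (intro local) auto
      then show ?thesis using IH by simp
    qed
  qed simp
  have total_gain: "f (T \<union> D) - f T \<le> f (A \<union> D) - f A"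
    if "finite D" "A \<subseteq> T" "T \<union> D \<subseteq> \<Omega>" "T \<inter> D = {}" for A T D
    using that
  proof (induction D)
    case (insert d D)
    have "T \<union> D = (A \<union> D) \<union> T"
      using \<open>A \<subseteq> T\<close> by blast
    moreover have "f (insert d ((A \<union> D) \<union> T)) - f ((A \<union> D) \<union> T) \<le> f (insert d (A \<union> D)) - f (A \<union> D)"
      using insert finite_subset[OF _ \<open>finite \<Omega>\<close>] by (intro gain) auto
    ultimately have "f (insert d (T \<union> D)) - f (T \<union> D) \<le> f (insert d (A \<union> D)) - f (A \<union> D)"
      by simp
    moreover have "f (T \<union> D) - f T \<le> f (A \<union> D) - f A"
      using insert by auto
    ultimately show ?case by simp
  qed simp
  show ?thesis
    unfolding submodular_on_def
  proof (intro allI impI)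
    fix S T assume "S \<subseteq> \<Omega>" "T \<subseteq> \<Omega>"
    then have "f (T \<union> (S - T)) - f T \<le> f ((S \<inter> T) \<union> (S - T)) - f (S \<inter> T)"
      using finite_subset[OF _ \<open>finite \<Omega>\<close>] by (intro total_gain) auto
    moreover have "T \<union> (S - T) = S \<union> T" "(S \<inter> T) \<union> (S - T) = S"
      by auto
    ultimately show "f (S \<union> T) + f (S \<inter> T) \<le> f S + f T"
      by simp
  qed
qed

theorem proposition3:
  fixes t n :: nat and f :: "nat set \<Rightarrow> real"
  assumes "sos_submodular t n f"
  shows "submodular_on {1..n} f"
proof (rule submodular_on_if_local)
  fix i j A
  assume ij: "i \<in> {1..n}" "j \<in> {1..n}" "i \<noteq> j" and A: "A \<subseteq> {1..n} - {i, j}"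
  have "eval_poly (indicator A) (- partial_deriv i (partial_deriv j (MLE n f))) \<ge> 0"
    using assms ij unfolding sos_submodular_def by (blast intro: sos_mod_boolean_ideal_nonneg)
  then show "f (insert i (insert j A)) + f A \<le> f (insert i A) + f (insert j A)"
    by (simp add: eval_poly_uminus eval_mixed_partial_deriv_MLE[OF ij A])
qed simp

end
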